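(* Let $p\in[1,\infty)$, $p^{-1}+q^{-1}=1$, and assume $\max\{\|f\|_p,\|f_1\|_p,\dots,\|f_N\|_p\}=:L<\infty$. Let $$\Psi=\widetilde\Psi_{I_N}:=\Big\{\psi_g(\cdot)=\frac{|g(\cdot)|^{p-1}}{\|g\|_p^{p-1}}\operatorname{sign}\{g(\cdot)\}\ :\ g=f_i-f_j,\ i,j\in I_N,\ i\ne j\Big\},$$ let $\varkappa:=\min\{\varkappa>0:\mathbb{P}[\max_{\psi\in\Psi}|Z(\psi)|/\|\psi\|_2\ge\varkappa]\le\varepsilon\}$, and let $\hat f=f_{\hat i}$ with $$\hat i:=\arg\min_{i\in I_N}\hat M_i,\qquad \hat M_i:=\max_{\psi\in\Psi}\Big\{\frac{1}{\|\psi\|_q}\big[|\Delta_i(\psi)|-\varepsilon\varkappa\|\psi\|_2\big]\Big\}.$$ Let $i_*:=\arg\min_{i\in I_N}\|f-f_i\|_p$. Then $$\mathcal{R}_p[\hat f;f]\le 3\min_{i\in I_N}\|f-f_i\|_p+2Q_1(p)\,\varepsilon\sqrt{2\ln\frac{N^2}{\varepsilon}}+2L\varepsilon,$$ where $Q_1(p)=1$ for $1\le p\le2$, and $$Q_1(p):=\max_{i\in I_N,\ i\neq i_*}\Big[\frac{\|f_{i_*}-f_i\|_{2p-2}}{\|f_{i_*}-f_i\|_p}\Big]^{p-1},\qquad 2<p<\infty.$$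
   Context: Model: $\mathcal{D}_0=[0,1]^d$, $\varepsilon\in(0,1)$, and one observes $\mathcal{Y}_\varepsilon$ in the Gaussian white noise model $Y_\varepsilon(dt)=f(t)\,dt+\varepsilon W(dt)$, $t\in\mathcal{D}_0$, with $f$ an unknown real function and $W$ the standard Wiener process in $\mathbb{R}^d$. Thus for a probe function $\psi\in\mathbb{L}_2(\mathcal{D}_0)$ one observes $\int\psi(t)Y_\varepsilon(dt)=\int\psi f\,dt+\varepsilon Z(\psi)$, where $Z(\psi)=\int\psi(t)W(dt)$ is the zero-mean Gaussian process, linear in $\psi$, with $\mathbb{E}[Z(\psi)Z(\phi)]=\int\psi\phi\,dt$. $\|\cdot\|_p$ is the $\mathbb{L}_p$-norm on $\mathcal{D}_0$ (Lebesgue measure); the risk of an estimator $\tilde f$ is $\mathcal{R}_p[\tilde f;f]:=\mathbb{E}_f\|\tilde f-f\|_p$, with $\mathbb{E}_f$ the expectation under the model with signal $f$. Family: $I_N=\{1,\dots,N\}$, $N\ge2$, and $f_1,\dots,f_N$ are distinct fixed (nonrandom) functions on $\mathcal{D}_0$. For a probe function $\psi$, $\Delta_i(\psi):=\int\psi(t)Y_\varepsilon(dt)-\int\psi(t)f_i(t)\,dt=\int\psi(t)[f(t)-f_i(t)]\,dt+\varepsilon Z(\psi)$. Conventions: for $p=1$ the probe function is $\psi_g=\operatorname{sign}(g)$, with $\operatorname{sign}(0)=0$; all integrals and norms appearing are finite; ties in $\arg\min$ are broken arbitrarily (measurably). *)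

theory Defs
  imports "HOL-Probability.Probability"
begin

text \<open>Lebesgue measure on the unit cube of \<open>\<real>\<^sup>d\<close>, where \<open>d = CARD('d)\<close>.\<close>

abbreviation cube_measure :: "(real ^ 'd) measure" where
  "cube_measure \<equiv> lebesgue_on (cbox 0 1)"

text \<open>
  The exponent ranges over \<open>ennreal\<close> so that the conjugate of \<open>1\<close> is \<open>\<infinity>\<close>.  The norm is
  real-valued and is meaningful only for members of \<open>Lp_space p\<close>.
\<close>

definition Lp_space :: "ennreal \<Rightarrow> (real ^ 'd \<Rightarrow> real) set" where
  "Lp_space p = {g \<in> borel_measurable cube_measure.
     if p = \<infinity> then esssup cube_measure (\<lambda>t. ennreal \<bar>g t\<bar>) < \<infinity>
     else integrable cube_measure (\<lambda>t. \<bar>g t\<bar> powr enn2real p)}"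

definition Lp_norm :: "ennreal \<Rightarrow> (real ^ 'd \<Rightarrow> real) \<Rightarrow> real" where
  "Lp_norm p g =
     (if p = \<infinity> then enn2real (esssup cube_measure (\<lambda>t. ennreal \<bar>g t\<bar>))
      else (\<integral>t. \<bar>g t\<bar> powr enn2real p \<partial>cube_measure) powr (1 / enn2real p))"

text \<open>Degenerate (almost surely zero) variables count as Gaussian.\<close>

definition centered_gaussian :: "'w measure \<Rightarrow> ('w \<Rightarrow> real) \<Rightarrow> bool" where
  "centered_gaussian P X \<longleftrightarrow> X \<in> borel_measurable P \<and>
     ((AE \<omega> in P. X \<omega> = 0) \<or> (\<exists>\<sigma>>0. distributed P lborel X (normal_density 0 \<sigma>)))"

text \<open>
  \<open>Z \<psi>\<close> is the Wiener integral of \<open>\<psi>\<close>: a centered Gaussian process indexed by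
  \<open>L\<^sub>2\<close> of the cube with the \<open>L\<^sub>2\<close> inner product as covariance.  Joint Gaussianity is
  expressed through finite linear combinations.  As for every stochastic integral, linearity
  holds almost surely, with an exceptional set that may depend on the arguments.
\<close>

locale white_noise = prob_space P
  for P :: "'w measure" +
  fixes Z :: "(real ^ 'd \<Rightarrow> real) \<Rightarrow> 'w \<Rightarrow> real"
  assumes gaussian: "\<And>S c. finite S \<Longrightarrow> S \<subseteq> Lp_space 2 \<Longrightarrow>
      centered_gaussian P (\<lambda>\<omega>. \<Sum>\<psi>\<in>S. c \<psi> * Z \<psi> \<omega>)"
    and covariance: "\<And>\<psi> \<phi>. \<psi> \<in> Lp_space 2 \<Longrightarrow> \<phi> \<in> Lp_space 2 \<Longrightarrow>
      expectation (\<lambda>\<omega>. Z \<psi> \<omega> * Z \<phi> \<omega>) = (\<integral>t. \<psi> t * \<phi> t \<partial>cube_measure)"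
    and linear: "\<And>\<psi> \<phi> a b. \<psi> \<in> Lp_space 2 \<Longrightarrow> \<phi> \<in> Lp_space 2 \<Longrightarrow>
      AE \<omega> in P. Z (\<lambda>t. a * \<psi> t + b * \<phi> t) \<omega> = a * Z \<psi> \<omega> + b * Z \<phi> \<omega>"

text \<open>The observation \<open>\<integral>\<psi>(t) Y(dt)\<close> for signal \<open>f\<close> and noise level \<open>\<epsilon>\<close>.\<close>

definition observation ::
  "((real ^ 'd \<Rightarrow> real) \<Rightarrow> 'w \<Rightarrow> real) \<Rightarrow> real \<Rightarrow> (real ^ 'd \<Rightarrow> real) \<Rightarrow>
   (real ^ 'd \<Rightarrow> real) \<Rightarrow> 'w \<Rightarrow> real" where
  "observation Z \<epsilon> f \<psi> \<omega> = (\<integral>t. \<psi> t * f t \<partial>cube_measure) + \<epsilon> * Z \<psi> \<omega>"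

definition discrepancy ::
  "((real ^ 'd \<Rightarrow> real) \<Rightarrow> 'w \<Rightarrow> real) \<Rightarrow> real \<Rightarrow> (real ^ 'd \<Rightarrow> real) \<Rightarrow>
   (real ^ 'd \<Rightarrow> real) \<Rightarrow> (real ^ 'd \<Rightarrow> real) \<Rightarrow> 'w \<Rightarrow> real" where
  "discrepancy Z \<epsilon> f h \<psi> \<omega> =
     observation Z \<epsilon> f \<psi> \<omega> - (\<integral>t. \<psi> t * h t \<partial>cube_measure)"

text \<open>For \<open>p = 1\<close> and \<open>g\<close> of positive norm this is \<open>sgn \<circ> g\<close>, with \<open>sgn 0 = 0\<close>.\<close>

definition probe :: "real \<Rightarrow> (real ^ 'd \<Rightarrow> real) \<Rightarrow> real ^ 'd \<Rightarrow> real" where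
  "probe p g t =
     \<bar>g t\<bar> powr (p - 1) / Lp_norm (ennreal p) g powr (p - 1) * sgn (g t)"

definition probe_set ::
  "real \<Rightarrow> (nat \<Rightarrow> real ^ 'd \<Rightarrow> real) \<Rightarrow> nat \<Rightarrow> (real ^ 'd \<Rightarrow> real) set" where
  "probe_set p fs N =
     {probe p (\<lambda>t. fs i t - fs j t) | i j. i \<in> {1..N} \<and> j \<in> {1..N} \<and> i \<noteq> j}"

definition critical_value ::
  "'w measure \<Rightarrow> ((real ^ 'd \<Rightarrow> real) \<Rightarrow> 'w \<Rightarrow> real) \<Rightarrow> real \<Rightarrow>
   (real ^ 'd \<Rightarrow> real) set \<Rightarrow> real" where
  "critical_value P Z \<epsilon> \<Psi> =
     (LEAST \<kappa>. 0 < \<kappa> \<and>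
        measure P {\<omega> \<in> space P. Max ((\<lambda>\<psi>. \<bar>Z \<psi> \<omega>\<bar> / Lp_norm 2 \<psi>) ` \<Psi>) \<ge> \<kappa>} \<le> \<epsilon>)"

definition selection_criterion ::
  "((real ^ 'd \<Rightarrow> real) \<Rightarrow> 'w \<Rightarrow> real) \<Rightarrow> real \<Rightarrow> (real ^ 'd \<Rightarrow> real) \<Rightarrow> real \<Rightarrow> ennreal \<Rightarrow>
   (real ^ 'd \<Rightarrow> real) set \<Rightarrow> (real ^ 'd \<Rightarrow> real) \<Rightarrow> 'w \<Rightarrow> real" where
  "selection_criterion Z \<epsilon> f \<kappa> q \<Psi> h \<omega> =
     Max ((\<lambda>\<psi>. 1 / Lp_norm q \<psi> *
            (\<bar>discrepancy Z \<epsilon> f h \<psi> \<omega>\<bar> - \<epsilon> * \<kappa> * Lp_norm 2 \<psi>)) ` \<Psi>)"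

definition risk ::
  "'w measure \<Rightarrow> ennreal \<Rightarrow> ('w \<Rightarrow> real ^ 'd \<Rightarrow> real) \<Rightarrow> (real ^ 'd \<Rightarrow> real) \<Rightarrow> real" where
  "risk P p est f = (\<integral>\<omega>. Lp_norm p (\<lambda>t. est \<omega> t - f t) \<partial>P)"

definition Q1 ::
  "real \<Rightarrow> (nat \<Rightarrow> real ^ 'd \<Rightarrow> real) \<Rightarrow> nat \<Rightarrow> nat \<Rightarrow> real" where
  "Q1 p fs N i0 =
     (if p \<le> 2 then 1
      else Max ((\<lambda>i. (Lp_norm (ennreal (2 * p - 2)) (\<lambda>t. fs i0 t - fs i t) /
                      Lp_norm (ennreal p) (\<lambda>t. fs i0 t - fs i t)) powr (p - 1))
                ` ({1..N} - {i0})))"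

end

theory Submission
  imports Defs
begin

text \<open>
  The probe of \<open>g\<close> is the normalized duality map of \<open>L\<^sub>p\<close>: it has conjugate norm one, it integrates
  against \<open>g\<close> to the norm of \<open>g\<close> (\<open>probe_integral_self\<close>), and it integrates against any \<open>h\<close> to at
  most the norm of \<open>h\<close> (\<open>probe_integral_le\<close>).  Suppose that \<open>\<bar>Z \<psi>\<bar> \<le> \<kappa> * Lp_norm 2 \<psi>\<close> for every
  probe.  Then the criterion at the oracle \<open>fs i_star\<close> is at most the oracle distance
  \<open>a = Lp_norm p (f - fs i_star)\<close>, and hence so is the criterion at the selected function.  Testing
  \<open>fs i_star - fs i_hat\<close> against its own probe \<open>\<psi>\<close> expresses the distance of these two functions
  as a difference of discrepancies, each at most \<open>a + \<epsilon> * \<kappa> * Lp_norm 2 \<psi>\<close>.  The triangle inequality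
  adds a further \<open>a\<close> and gives the bound \<open>3 * a + 2 * \<epsilon> * \<kappa> * Lp_norm 2 \<psi>\<close>
  (\<open>selection_oracle_inequality\<close>).

  The norm \<open>Lp_norm 2 \<psi>\<close> is at most \<open>Q1\<close>: for \<open>p > 2\<close> it is one of the ratios in the definition of
  \<open>Q1\<close>, and for \<open>p \<le> 2\<close> it is at most one because the cube has volume one.

  The noise normalized by \<open>Lp_norm 2 \<psi>\<close> is standard normal.  The maximum of its absolute value over
  the probes is therefore positive almost surely and has no atoms, so the critical value \<open>\<kappa>\<close> exists, and
  the noise bound fails with probability at most \<open>\<epsilon>\<close>.  The union bound over at most \<open>N\<^sup>2\<close> probes,
  with the tail \<open>exp (- x\<^sup>2 / 2)\<close> for each of them, yields \<open>\<kappa> \<le> sqrt (2 * ln (N\<^sup>2 / \<epsilon>))\<close>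
  (\<open>critical_value\<close>).  On the exceptional event the error is at most \<open>2 * L\<close>, which adds
  \<open>2 * L * \<epsilon>\<close> to the risk.
\<close>

section \<open>Duality between functions and their probes\<close>

lemma prob_space_cube: "prob_space (cube_measure :: (real ^ 'd) measure)"
proof
  have one: "(1 :: real ^ 'd) \<bullet> b = 1" if "b \<in> Basis" for b
    using that by (auto simp: Basis_vec_def inner_axis)
  have "emeasure lborel (cbox (0 :: real ^ 'd) 1) = 1"
    by (subst emeasure_lborel_cbox_eq) (simp add: one)
  then show "emeasure (cube_measure :: (real ^ 'd) measure) (space cube_measure) = 1"
    by (simp add: emeasure_restrict_space)
qed

lemma Lp_spaceD:
  assumes "g \<in> Lp_space (ennreal r)" "0 \<le> r"
  shows "g \<in> borel_measurable cube_measure" "integrable cube_measure (\<lambda>t. \<bar>g t\<bar> powr r)"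
  using assms by (simp_all add: Lp_space_def)

lemma Lp_spaceI:
  assumes "g \<in> borel_measurable cube_measure" "integrable cube_measure (\<lambda>t. \<bar>g t\<bar> powr r)" "0 \<le> r"
  shows "g \<in> Lp_space (ennreal r)"
  using assms by (simp add: Lp_space_def)

lemma Lp_norm_eq: "0 \<le> r \<Longrightarrow> Lp_norm (ennreal r) g = (\<integral>t. \<bar>g t\<bar> powr r \<partial>cube_measure) powr (1 / r)"
  by (simp add: Lp_norm_def)

lemma Lp_norm_nonneg: "0 \<le> Lp_norm (ennreal r) g"
  by (simp add: Lp_norm_def)

lemma Lp_norm_powr:
  assumes "0 < r"
  shows "Lp_norm (ennreal r) g powr r = (\<integral>t. \<bar>g t\<bar> powr r \<partial>cube_measure)"
  using assms by (simp add: Lp_norm_eq powr_powr)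

lemma Lp_norm_pos:
  assumes "g \<in> Lp_space (ennreal r)" "0 < r" "\<not> (AE t in cube_measure. g t = 0)"
  shows "0 < Lp_norm (ennreal r) g"
proof -
  have "(\<integral>t. \<bar>g t\<bar> powr r \<partial>cube_measure) \<noteq> 0"
    using assms Lp_spaceD[OF assms(1)] by (subst integral_nonneg_eq_0_iff_AE) auto
  moreover have "(\<integral>t. \<bar>g t\<bar> powr r \<partial>cube_measure) \<ge> 0"
    by simp
  ultimately show ?thesis
    using assms by (simp add: Lp_norm_eq)
qed

lemma Lp_norm_minus_commute:
  "Lp_norm r (\<lambda>t. g t - h t) = Lp_norm r (\<lambda>t. h t - g t)"
  by (simp add: Lp_norm_def abs_minus_commute)

lemma Lp_space_diff:
  assumes g: "g \<in> Lp_space (ennreal r)" and h: "h \<in> Lp_space (ennreal r)" and r: "0 \<le> r"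
  shows "(\<lambda>t. g t - h t) \<in> Lp_space (ennreal r)"
proof (rule Lp_spaceI)
  note [measurable] = Lp_spaceD(1)[OF g r] Lp_spaceD(1)[OF h r]
  show "(\<lambda>t. g t - h t) \<in> borel_measurable cube_measure"
    by measurable
  have bound: "\<bar>x - y\<bar> powr r \<le> 2 powr r * (\<bar>x\<bar> powr r + \<bar>y\<bar> powr r)" for x y :: real
  proof -
    have "\<bar>x - y\<bar> powr r \<le> (2 * max \<bar>x\<bar> \<bar>y\<bar>) powr r"
      using r by (intro powr_mono2) auto
    also have "\<dots> = 2 powr r * max \<bar>x\<bar> \<bar>y\<bar> powr r"
      by (simp add: powr_mult)
    also have "\<dots> \<le> 2 powr r * (\<bar>x\<bar> powr r + \<bar>y\<bar> powr r)"
      by (auto simp: max_def)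
    finally show ?thesis .
  qed
  show "integrable cube_measure (\<lambda>t. \<bar>g t - h t\<bar> powr r)"
  proof (rule Bochner_Integration.integrable_bound)
    show "integrable cube_measure (\<lambda>t. 2 powr r * (\<bar>g t\<bar> powr r + \<bar>h t\<bar> powr r))"
      using Lp_spaceD(2)[OF g r] Lp_spaceD(2)[OF h r] by simp
    show "AE t in cube_measure. norm (\<bar>g t - h t\<bar> powr r) \<le> norm (2 powr r * (\<bar>g t\<bar> powr r + \<bar>h t\<bar> powr r))"
      using bound by simp
  qed measurable
qed (use r in simp)

text \<open>
  Young's inequality with the conjugate exponent \<open>p / (p - 1)\<close> eliminated, so that \<open>p = 1\<close> is included.
\<close>

lemma Young_powr:
  fixes a b p :: real
  assumes "0 \<le> a" "0 \<le> b" "1 \<le> p"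
  shows "a powr (p - 1) * b \<le> (p - 1) / p * a powr p + b powr p / p"
proof (cases "p = 1")
  case True
  then show ?thesis using assms by simp
next
  case False
  with assms have p: "1 < p" by simp
  have "a powr (p - 1) * b \<le> (a powr (p - 1)) powr (p / (p - 1)) / (p / (p - 1)) + b powr p / p"
    using assms p by (intro Youngs_inequality) (auto simp: field_simps)
  also have "(a powr (p - 1)) powr (p / (p - 1)) = a powr p"
    using p by (simp add: powr_powr)
  finally show ?thesis by (simp add: field_simps)
qed

lemma probe_measurable:
  assumes [measurable]: "g \<in> borel_measurable cube_measure"
  shows "probe p g \<in> borel_measurable cube_measure"
  unfolding probe_def[abs_def] by measurable

text \<open>
  At \<open>p = 1\<close> the convention \<open>0 powr 0 = 0\<close> agrees with \<open>sgn 0 = 0\<close>.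
\<close>

lemma abs_probe:
  "\<bar>probe p g t\<bar> = \<bar>g t\<bar> powr (p - 1) / Lp_norm (ennreal p) g powr (p - 1)"
  by (simp add: probe_def abs_mult abs_sgn_eq)

text \<open>
  Scale \<open>g\<close> by its norm and \<open>h\<close> by any positive \<open>d\<close> above its norm; then both \<open>p\<close>-th powers have
  integral at most one, and integrating Young's inequality gives a bound
  \<open>d * ((p - 1) / p + 1 / p) = d\<close>.  This is Hoelder's inequality with a factor of conjugate norm one;
  working with the probe rather than the conjugate exponent covers \<open>p = 1\<close> as well.
\<close>

lemma probe_integral_bound:
  assumes p: "1 \<le> p" and g: "g \<in> Lp_space (ennreal p)" and h: "h \<in> Lp_space (ennreal p)"
    and pos: "0 < Lp_norm (ennreal p) g"
  shows probe_times_integrable: "integrable cube_measure (\<lambda>t. probe p g t * h t)"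
    and probe_integral_le: "\<bar>\<integral>t. probe p g t * h t \<partial>cube_measure\<bar> \<le> Lp_norm (ennreal p) h"
proof -
  define c where "c = Lp_norm (ennreal p) g"
  have p0: "0 \<le> p" "0 < p" using p by auto
  have c: "0 < c" using pos by (simp add: c_def)
  note [measurable] = Lp_spaceD(1)[OF g p0(1)] Lp_spaceD(1)[OF h p0(1)]
  note int = Lp_spaceD(2)[OF g p0(1)] Lp_spaceD(2)[OF h p0(1)]
  have [measurable]: "probe p g \<in> borel_measurable cube_measure"
    by (rule probe_measurable) measurable
  define B where "B d t = d * ((p - 1) / p * (\<bar>g t\<bar> powr p / c powr p) + \<bar>h t\<bar> powr p / d powr p / p)" for d t
  have B: "integrable cube_measure (B d)" for d
    unfolding B_def[abs_def] using int by simp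
  have pw: "\<bar>probe p g t * h t\<bar> \<le> B d t" if "0 < d" for d t
  proof -
    have "\<bar>probe p g t * h t\<bar> \<le> d * ((\<bar>g t\<bar> / c) powr (p - 1) * (\<bar>h t\<bar> / d))"
      using that c by (simp add: abs_mult abs_probe powr_divide c_def)
    also have "\<dots> \<le> d * ((p - 1) / p * (\<bar>g t\<bar> / c) powr p + (\<bar>h t\<bar> / d) powr p / p)"
      using that c p by (intro mult_left_mono Young_powr) auto
    also have "\<dots> = B d t"
      using that c by (simp add: B_def powr_divide)
    finally show ?thesis .
  qed
  show I: "integrable cube_measure (\<lambda>t. probe p g t * h t)"
    by (rule Bochner_Integration.integrable_bound[OF B[of 1]])
       (measurable, use pw[of 1] in \<open>auto intro!: AE_I2 intro: order_trans abs_ge_self\<close>)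
  have "\<bar>\<integral>t. probe p g t * h t \<partial>cube_measure\<bar> \<le> d" if d: "Lp_norm (ennreal p) h < d" for d
  proof -
    have d0: "0 < d" using d Lp_norm_nonneg[of p h] by linarith
    have "\<bar>\<integral>t. probe p g t * h t \<partial>cube_measure\<bar> \<le> (\<integral>t. B d t \<partial>cube_measure)"
      using pw[OF d0] I B by (intro order_trans[OF integral_abs_bound] integral_mono) auto
    also have "\<dots> = d * ((p - 1) / p * (c powr p / c powr p) + Lp_norm (ennreal p) h powr p / d powr p / p)"
      unfolding B_def using int p0 by (simp add: Lp_norm_powr c_def)
    also have "\<dots> \<le> d * ((p - 1) / p * 1 + 1 / p)"
      using c d0 d p0 Lp_norm_nonneg[of p h]
      by (intro mult_left_mono add_mono divide_right_mono) (use p in \<open>auto intro!: powr_mono2 simp: field_simps\<close>)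
    also have "\<dots> = d" using p0 by (simp add: field_simps)
    finally show ?thesis .
  qed
  then show "\<bar>\<integral>t. probe p g t * h t \<partial>cube_measure\<bar> \<le> Lp_norm (ennreal p) h"
    by (rule dense_ge)
qed

text \<open>
  The probe attains equality in Hoelder's inequality against the function that it comes from.
\<close>

lemma probe_integral_self:
  assumes p: "1 \<le> p" and pos: "0 < Lp_norm (ennreal p) g"
  shows "(\<integral>t. probe p g t * g t \<partial>cube_measure) = Lp_norm (ennreal p) g"
proof -
  define c where "c = Lp_norm (ennreal p) g"
  have "probe p g t * g t = \<bar>g t\<bar> powr p / c powr (p - 1)" for t
  proof (cases "g t = 0")
    case False
    then have "\<bar>g t\<bar> powr (p - 1) * (sgn (g t) * g t) = \<bar>g t\<bar> powr p"
      using abs_sgn[of "g t"] by (simp add: powr_diff mult.commute)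
    then show ?thesis by (simp add: probe_def c_def mult_ac)
  qed (simp add: probe_def)
  then have "(\<integral>t. probe p g t * g t \<partial>cube_measure) = c powr p / c powr (p - 1)"
    using p by (simp add: Lp_norm_powr c_def)
  also have "\<dots> = c powr (p - (p - 1))"
    by (rule powr_diff[symmetric])
  finally show ?thesis using pos by (simp add: c_def)
qed

text \<open>
  By duality, the norm of \<open>g - k\<close> is the integral of \<open>g - k\<close> against its own probe.  This integral
  splits additively, and each part is at most the norm of the corresponding difference.
\<close>

lemma Lp_norm_triangle:
  assumes p: "1 \<le> p" and g: "g \<in> Lp_space (ennreal p)" and h: "h \<in> Lp_space (ennreal p)"
    and k: "k \<in> Lp_space (ennreal p)"
  shows "Lp_norm (ennreal p) (\<lambda>t. g t - k t)
    \<le> Lp_norm (ennreal p) (\<lambda>t. g t - h t) + Lp_norm (ennreal p) (\<lambda>t. h t - k t)"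
proof (cases "0 < Lp_norm (ennreal p) (\<lambda>t. g t - k t)")
  case True
  have p0: "0 \<le> p" using p by simp
  define \<psi> where "\<psi> = probe p (\<lambda>t. g t - k t)"
  have gk: "(\<lambda>t. g t - k t) \<in> Lp_space (ennreal p)" and gh: "(\<lambda>t. g t - h t) \<in> Lp_space (ennreal p)"
    and hk: "(\<lambda>t. h t - k t) \<in> Lp_space (ennreal p)"
    by (rule Lp_space_diff[OF _ _ p0]; fact)+
  have "Lp_norm (ennreal p) (\<lambda>t. g t - k t) = (\<integral>t. \<psi> t * (g t - k t) \<partial>cube_measure)"
    unfolding \<psi>_def by (rule probe_integral_self[OF p True, symmetric])
  also have "\<dots> = (\<integral>t. \<psi> t * (g t - h t) + \<psi> t * (h t - k t) \<partial>cube_measure)"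
    by (simp add: algebra_simps)
  also have "\<dots> = (\<integral>t. \<psi> t * (g t - h t) \<partial>cube_measure) + (\<integral>t. \<psi> t * (h t - k t) \<partial>cube_measure)"
    unfolding \<psi>_def
    by (rule Bochner_Integration.integral_add) (rule probe_times_integrable[OF p gk _ True]; fact)+
  also have "\<dots> \<le> Lp_norm (ennreal p) (\<lambda>t. g t - h t) + Lp_norm (ennreal p) (\<lambda>t. h t - k t)"
    using probe_integral_le[OF p gk gh True] probe_integral_le[OF p gk hk True]
    unfolding \<psi>_def by linarith
  finally show ?thesis .
next
  case False
  then show ?thesis using Lp_norm_nonneg[of p] by (smt (verit))
qed

lemma Lp_norm_diff_le:
  assumes p: "1 \<le> p" and g: "g \<in> Lp_space (ennreal p)" and h: "h \<in> Lp_space (ennreal p)"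
  shows "Lp_norm (ennreal p) (\<lambda>t. g t - h t) \<le> Lp_norm (ennreal p) g + Lp_norm (ennreal p) h"
proof -
  have "(\<lambda>t. 0) \<in> Lp_space (ennreal p)"
    using p by (intro Lp_spaceI) auto
  from Lp_norm_triangle[OF p g this h] show ?thesis
    using Lp_norm_minus_commute[of "ennreal p" "\<lambda>_. 0" h] by simp
qed

text \<open>
  For \<open>p = 1\<close> the probe is \<open>sgn \<circ> g\<close>, and its essential supremum is exactly one because \<open>g\<close> does not
  vanish almost everywhere.
\<close>

lemma Lp_norm_conjugate_probe:
  assumes p: "1 \<le> p" and q: "1 / ennreal p + 1 / q = 1" and g: "g \<in> Lp_space (ennreal p)"
    and pos: "0 < Lp_norm (ennreal p) g"
  shows "Lp_norm q (probe p g) = 1"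
proof (cases "p = 1")
  case True
  have [measurable]: "g \<in> borel_measurable cube_measure"
    using Lp_spaceD(1)[OF g] p by simp
  have "1 / q = 0"
    using q True ennreal_add_left_cancel[of 1 "1 / q" 0] by simp
  then have q: "q = \<infinity>"
    by (simp add: ennreal_divide_eq_0_iff)
  have [measurable]: "probe p g \<in> borel_measurable cube_measure"
    by (rule probe_measurable) measurable
  have [measurable]: "(\<lambda>t. ennreal \<bar>probe p g t\<bar>) \<in> borel_measurable cube_measure"
    by measurable
  have abs: "\<bar>probe p g t\<bar> = (if g t = 0 then 0 else 1)" for t
    using True pos by (simp add: abs_probe)
  have "esssup cube_measure (\<lambda>t. ennreal \<bar>probe p g t\<bar>) = 1"
  proof (rule antisym)
    show "esssup cube_measure (\<lambda>t. ennreal \<bar>probe p g t\<bar>) \<le> 1"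
      by (rule esssup_I) (auto simp: abs)
    show "1 \<le> esssup cube_measure (\<lambda>t. ennreal \<bar>probe p g t\<bar>)"
    proof (rule ccontr)
      assume "\<not> 1 \<le> esssup cube_measure (\<lambda>t. ennreal \<bar>probe p g t\<bar>)"
      then have less: "esssup cube_measure (\<lambda>t. ennreal \<bar>probe p g t\<bar>) < 1" by simp
      have "AE t in cube_measure. ennreal \<bar>probe p g t\<bar> \<le> esssup cube_measure (\<lambda>t. ennreal \<bar>probe p g t\<bar>)"
        by (rule esssup_AE) 
      then have "AE t in cube_measure. g t = 0"
      proof (rule AE_mp, intro AE_I2 impI)
        fix t assume "ennreal \<bar>probe p g t\<bar> \<le> esssup cube_measure (\<lambda>t. ennreal \<bar>probe p g t\<bar>)"
        then have "ennreal \<bar>probe p g t\<bar> < 1" using less by (rule le_less_trans)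
        then show "g t = 0" by (simp add: abs split: if_splits)
      qed
      then have "Lp_norm (ennreal p) g = 0"
        using p by (subst Lp_norm_eq) (auto simp: integral_eq_zero_AE)
      with pos show False by simp
    qed
  qed
  then show ?thesis by (simp add: Lp_norm_def q)
next
  case False
  then have p1: "1 < p" using p by simp
  define c where "c = Lp_norm (ennreal p) g"
  have "q = ennreal (p / (p - 1))"
  proof (cases q)
    case (real r)
    have "r \<noteq> 0"
    proof
      assume "r = 0"
      with real q show False by simp
    qed
    then have r: "0 < r" using real by simp
    have "ennreal (1 / p + 1 / r) = 1"
      using q real r p1 by (simp add: ennreal_plus divide_ennreal[symmetric] flip: ennreal_1)
    then have "1 / p + 1 / r = 1" by (simp only: ennreal_eq_1)
    then have "r = p / (p - 1)" using r p1 by (simp add: field_simps)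
    with real show ?thesis by simp
  next
    case top
    with q have "1 / ennreal p = 1" by simp
    then have "ennreal (1 / p) = 1" using p1 by (simp add: divide_ennreal[symmetric] flip: ennreal_1)
    then show ?thesis using p1 by simp
  qed
  moreover have "\<bar>probe p g t\<bar> powr (p / (p - 1)) = \<bar>g t\<bar> powr p / c powr p" for t
    using p1 by (simp add: abs_probe powr_divide powr_powr c_def)
  moreover have "c powr p > 0" using pos by (simp add: c_def)
  ultimately show ?thesis
    using p1 by (simp add: Lp_norm_eq Lp_norm_powr[of p g, symmetric] c_def[symmetric])
qed

lemma probe_square:
  "\<bar>probe p g t\<bar> powr 2 = \<bar>g t\<bar> powr (2 * p - 2) / Lp_norm (ennreal p) g powr (2 * p - 2)"
proof -
  have "(p - 1) * 2 = 2 * p - 2" by simp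
  then show ?thesis
    by (simp only: abs_probe powr_divide powr_powr)
qed

text \<open>
  For \<open>p \<le> 2\<close> the squared probe is dominated by a multiple of \<open>1 + \<bar>g\<bar> powr p\<close>, since
  \<open>2 * p - 2 \<le> p\<close>.
\<close>

lemma probe_in_L2:
  assumes p: "1 \<le> p" and g: "g \<in> Lp_space (ennreal p)"
    and fin: "2 < p \<Longrightarrow> g \<in> Lp_space (ennreal (2 * p - 2))"
  shows "probe p g \<in> Lp_space 2"
proof -
  have p0: "0 \<le> p" using p by simp
  note [measurable] = Lp_spaceD(1)[OF g p0]
  have [measurable]: "probe p g \<in> borel_measurable cube_measure"
    by (rule probe_measurable) measurable
  interpret cube: prob_space "cube_measure :: (real ^ 'a) measure" by (rule prob_space_cube)
  have i: "integrable cube_measure (\<lambda>t. \<bar>g t\<bar> powr (2 * p - 2))"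
  proof (cases "2 < p")
    case True
    then show ?thesis using Lp_spaceD(2)[OF fin] by simp
  next
    case False
    show ?thesis
    proof (rule Bochner_Integration.integrable_bound)
      show "integrable cube_measure (\<lambda>t. 1 + \<bar>g t\<bar> powr p)"
        using Lp_spaceD(2)[OF g p0] by simp
      have "\<bar>x\<bar> powr (2 * p - 2) \<le> 1 + \<bar>x\<bar> powr p" for x :: real
      proof (cases "\<bar>x\<bar> \<le> 1")
        case True
        then have "\<bar>x\<bar> powr (2 * p - 2) \<le> 1"
          using p by (intro powr_le1) auto
        then show ?thesis by (smt (verit) powr_ge_zero)
      next
        case le: False
        then have "\<bar>x\<bar> powr (2 * p - 2) \<le> \<bar>x\<bar> powr p"
          using False by (intro powr_mono) auto
        then show ?thesis by simp
      qed
      then show "AE t in cube_measure. norm (\<bar>g t\<bar> powr (2 * p - 2)) \<le> norm (1 + \<bar>g t\<bar> powr p)"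
        by simp
    qed measurable
  qed
  have "integrable cube_measure (\<lambda>t. \<bar>probe p g t\<bar> powr 2)"
    by (rule Bochner_Integration.integrable_bound[OF
          integrable_divide[OF i, of "Lp_norm (ennreal p) g powr (2 * p - 2)"]])
       (measurable, auto simp: probe_square)
  then have "probe p g \<in> Lp_space (ennreal 2)"
    by (intro Lp_spaceI) simp_all
  then show ?thesis by simp
qed

text \<open>
  A probe that vanished almost everywhere could not integrate against \<open>g\<close> to the norm of \<open>g\<close>.
\<close>

lemma probe_L2_pos:
  assumes p: "1 \<le> p" and g: "g \<in> Lp_space (ennreal p)" and pos: "0 < Lp_norm (ennreal p) g"
    and \<psi>: "probe p g \<in> Lp_space 2"
  shows "0 < Lp_norm 2 (probe p g)"
proof -
  have "\<not> (AE t in cube_measure. probe p g t = 0)"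
  proof
    assume "AE t in cube_measure. probe p g t = 0"
    then have "(\<integral>t. probe p g t * g t \<partial>cube_measure) = 0"
      by (intro integral_eq_zero_AE) auto
    with probe_integral_self[OF p pos] pos show False by simp
  qed
  with Lp_norm_pos[of "probe p g" 2] \<psi> show ?thesis by simp
qed

lemma probe_L2_norm:
  assumes p: "1 < p"
  shows "Lp_norm 2 (probe p g) = (Lp_norm (ennreal (2 * p - 2)) g / Lp_norm (ennreal p) g) powr (p - 1)"
proof -
  define c where "c = Lp_norm (ennreal p) g"
  define e where "e = Lp_norm (ennreal (2 * p - 2)) g"
  have "\<bar>probe p g t\<bar> powr 2 = \<bar>g t\<bar> powr (2 * p - 2) / c powr (2 * p - 2)" for t
    by (simp add: probe_square c_def)
  then have "(\<integral>t. \<bar>probe p g t\<bar> powr 2 \<partial>cube_measure) = (e / c) powr (2 * p - 2)"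
    using p by (simp add: Lp_norm_powr[symmetric] e_def powr_divide)
  then have "Lp_norm (ennreal 2) (probe p g) = (e / c) powr ((2 * p - 2) / 2)"
    by (simp only: Lp_norm_eq powr_powr) (simp add: powr_powr)
  then show ?thesis by (simp add: c_def e_def diff_divide_distrib)
qed

text \<open>
  For \<open>p \<le> 2\<close> the exponent \<open>2 * p - 2\<close> is \<open>\<theta> * p\<close> with \<open>0 \<le> \<theta> \<le> 1\<close>.  Hence the squared probe is
  \<open>y powr \<theta> \<le> (1 - \<theta>) + \<theta> * y\<close>, where \<open>y = \<bar>g\<bar> powr p / \<parallel>g\<parallel> powr p\<close> has integral one over the cube,
  and so has the constant one.
\<close>

lemma probe_L2_norm_le_1:
  assumes p: "1 \<le> p" "p \<le> 2" and g: "g \<in> Lp_space (ennreal p)" and pos: "0 < Lp_norm (ennreal p) g"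
  shows "Lp_norm 2 (probe p g) \<le> 1"
proof -
  define c where "c = Lp_norm (ennreal p) g"
  have p0: "0 \<le> p" "0 < p" using p by auto
  have c: "0 < c" using pos by (simp add: c_def)
  interpret cube: prob_space "cube_measure :: (real ^ 'a) measure" by (rule prob_space_cube)
  have \<psi>: "probe p g \<in> Lp_space (ennreal 2)"
    using probe_in_L2[OF p(1) g] p by simp
  define \<theta> where "\<theta> = (2 * p - 2) / p"
  have \<theta>: "0 \<le> \<theta>" "\<theta> \<le> 1" using p by (auto simp: \<theta>_def field_simps)
  have pw: "\<bar>probe p g t\<bar> powr 2 \<le> (1 - \<theta>) + \<theta> * (\<bar>g t\<bar> powr p / c powr p)" for t
  proof (cases "g t = 0")
    case True
    then show ?thesis using \<theta> by (simp add: probe_square)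
  next
    case False
    define y where "y = \<bar>g t\<bar> powr p / c powr p"
    have y: "0 < y" using False c by (simp add: y_def)
    have "\<bar>probe p g t\<bar> powr 2 = y powr \<theta>"
      using False p0 by (simp add: probe_square y_def powr_divide powr_powr \<theta>_def c_def)
    also have "\<dots> = 1 powr (1 - \<theta>) * y powr \<theta>" by simp
    also have "\<dots> \<le> (1 - \<theta>) * 1 + \<theta> * y"
      using \<theta> y by (intro Youngs_inequality_0) auto
    finally show ?thesis by (simp add: y_def)
  qed
  have mass: "measure (cube_measure :: (real ^ 'a) measure) (cbox 0 1) = 1"
    using cube.prob_space by simp
  have E: "(\<integral>t. \<bar>g t\<bar> powr p \<partial>cube_measure) = c powr p"
    using p0 by (simp add: Lp_norm_powr c_def)
  have "(\<integral>t. \<bar>probe p g t\<bar> powr 2 \<partial>cube_measure)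
      \<le> (\<integral>t. (1 - \<theta>) + \<theta> * (\<bar>g t\<bar> powr p / c powr p) \<partial>cube_measure)"
    using pw Lp_spaceD(2)[OF g p0(1)] Lp_spaceD(2)[OF \<psi>] by (intro integral_mono) auto
  also have "\<dots> = (1 - \<theta>) + \<theta> * (c powr p / c powr p)"
    using Lp_spaceD(2)[OF g p0(1)] by (simp add: E mass)
  also have "\<dots> = 1" using c by simp
  finally have "(\<integral>t. \<bar>probe p g t\<bar> powr 2 \<partial>cube_measure) \<le> 1" .
  then have "Lp_norm (ennreal 2) (probe p g) \<le> 1"
    by (simp only: Lp_norm_eq) (auto intro!: powr_le1)
  then show ?thesis by simp
qed

section \<open>The critical value\<close>

text \<open>
  Completing the square produces a cross term \<open>- x * y\<close> in the exponent, which has the right sign.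
\<close>

lemma std_normal_density_add_le:
  assumes "0 \<le> x * y"
  shows "std_normal_density (x + y) \<le> exp (- x\<^sup>2 / 2) * std_normal_density y"
proof -
  have "exp (- (x + y)\<^sup>2 / 2) \<le> exp (- x\<^sup>2 / 2) * exp (- y\<^sup>2 / 2)"
    using assms by (simp add: mult_exp_exp power2_sum field_simps)
  then have "1 / sqrt (2 * pi) * exp (- (x + y)\<^sup>2 / 2) \<le> 1 / sqrt (2 * pi) * (exp (- x\<^sup>2 / 2) * exp (- y\<^sup>2 / 2))"
    by (rule mult_left_mono) simp
  then show ?thesis
    by (simp add: std_normal_density_def mult_ac)
qed

text \<open>
  Shifting either half-line \<open>y \<ge> x\<close>, \<open>y \<le> - x\<close> to the origin costs a factor \<open>exp (- x\<^sup>2 / 2)\<close>,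
  and the two shifted half-lines together have mass one.
\<close>

lemma (in prob_space) std_normal_tail:
  assumes D: "distributed M lborel X std_normal_density" and x: "0 \<le> x"
  shows "prob {\<omega> \<in> space M. x \<le> \<bar>X \<omega>\<bar>} \<le> exp (- x\<^sup>2 / 2)"
proof -
  let ?\<phi> = "\<lambda>y. ennreal (std_normal_density y)"
  let ?e = "ennreal (exp (- x\<^sup>2 / 2))"
  have "emeasure M (X -` {y. x \<le> \<bar>y\<bar>} \<inter> space M) = (\<integral>\<^sup>+y. ?\<phi> y * indicator {y. x \<le> \<bar>y\<bar>} y \<partial>lborel)"
    by (rule distributed_emeasure[OF D]) simp
  also have "\<dots> \<le> (\<integral>\<^sup>+y. ?\<phi> y * indicator {x..} y + ?\<phi> y * indicator {..-x} y \<partial>lborel)"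
    by (intro nn_integral_mono) (auto simp: indicator_def)
  also have "\<dots> = (\<integral>\<^sup>+y. ?\<phi> y * indicator {x..} y \<partial>lborel) + (\<integral>\<^sup>+y. ?\<phi> y * indicator {..-x} y \<partial>lborel)"
    by (rule nn_integral_add) auto
  also have "(\<integral>\<^sup>+y. ?\<phi> y * indicator {x..} y \<partial>lborel) = (\<integral>\<^sup>+y. ?\<phi> (x + y) * indicator {x..} (x + y) \<partial>lborel)"
    by (subst nn_integral_real_affine[where c = 1 and t = x]) auto
  also have "\<dots> \<le> (\<integral>\<^sup>+y. ?e * (?\<phi> y * indicator {0<..} y) \<partial>lborel)"
  proof (rule nn_integral_mono_AE)
    \<comment> \<open>\<open>y = 0\<close> is left to the other half-line, so that the two parts below are disjoint\<close>
    have "AE y in lborel. y \<noteq> (0::real)" by (rule AE_lborel_singleton)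
    then show "AE y in lborel. ?\<phi> (x + y) * indicator {x..} (x + y) \<le> ?e * (?\<phi> y * indicator {0<..} y)"
      by eventually_elim
         (use x std_normal_density_add_le[of x] in \<open>auto simp: indicator_def ennreal_mult[symmetric] intro!: ennreal_leI\<close>)
  qed
  also have "(\<integral>\<^sup>+y. ?\<phi> y * indicator {..-x} y \<partial>lborel) = (\<integral>\<^sup>+y. ?\<phi> (- x + y) * indicator {..-x} (- x + y) \<partial>lborel)"
    by (subst nn_integral_real_affine[where c = 1 and t = "- x"]) auto
  also have "\<dots> \<le> (\<integral>\<^sup>+y. ?e * (?\<phi> y * indicator {..0} y) \<partial>lborel)"
    using x std_normal_density_add_le[of "- x"]
    by (intro nn_integral_mono)
       (auto simp: indicator_def ennreal_mult[symmetric] mult_nonneg_nonpos intro!: ennreal_leI)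
  also have "(\<integral>\<^sup>+y. ?e * (?\<phi> y * indicator {0<..} y) \<partial>lborel) + (\<integral>\<^sup>+y. ?e * (?\<phi> y * indicator {..0} y) \<partial>lborel)
      = (\<integral>\<^sup>+y. ?e * (?\<phi> y * indicator {0<..} y) + ?e * (?\<phi> y * indicator {..0} y) \<partial>lborel)"
    by (rule nn_integral_add[symmetric]) auto
  also have "\<dots> = (\<integral>\<^sup>+y. ?e * ?\<phi> y \<partial>lborel)"
    by (intro nn_integral_cong) (auto simp: indicator_def)
  also have "\<dots> = ?e * (\<integral>\<^sup>+y. ?\<phi> y \<partial>lborel)"
    by (rule nn_integral_cmult) simp
  also have "(\<integral>\<^sup>+y. ?\<phi> y \<partial>lborel) = 1"
    by (subst nn_integral_eq_integral) auto
  finally have "emeasure M (X -` {y. x \<le> \<bar>y\<bar>} \<inter> space M) \<le> ?e"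
    by (simp add: add_mono)
  also have "X -` {y. x \<le> \<bar>y\<bar>} \<inter> space M = {\<omega> \<in> space M. x \<le> \<bar>X \<omega>\<bar>}" by auto
  finally show ?thesis
    by (simp add: emeasure_eq_measure)
qed

text \<open>
  The infimum of \<open>{\<kappa>. 0 < \<kappa> \<and> P (X \<ge> \<kappa>) \<le> \<epsilon>}\<close> is attained because the distribution function of an
  atomless variable is continuous, and it is positive because \<open>P (X > 0) = 1 > \<epsilon>\<close>.
\<close>

lemma (in prob_space) upper_quantile_attained:
  fixes X :: "'a \<Rightarrow> real" and \<epsilon> :: real
  assumes X [measurable]: "random_variable borel X"
    and pos: "AE \<omega> in M. 0 < X \<omega>"
    and atomless: "\<And>x. 0 < x \<Longrightarrow> prob {\<omega> \<in> space M. X \<omega> = x} = 0"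
    and \<epsilon>: "0 < \<epsilon>" "\<epsilon> < 1"
  defines "S \<equiv> {\<kappa>. 0 < \<kappa> \<and> prob {\<omega> \<in> space M. \<kappa> \<le> X \<omega>} \<le> \<epsilon>}"
  shows "Inf S \<in> S" "\<And>x. x \<in> S \<Longrightarrow> Inf S \<le> x"
proof -
  interpret D: real_distribution "distr M borel X"
    using X by (rule real_distribution_distr)
  let ?F = "cdf (distr M borel X)"
  have F: "?F x = prob {\<omega> \<in> space M. X \<omega> \<le> x}" for x
    by (simp add: cdf_def measure_distr vimage_def Int_def conj_commute)
  have null: "prob {\<omega> \<in> space M. X \<omega> = x} = 0" for x
  proof (cases "0 < x")
    case False
    have "AE \<omega> in M. X \<omega> \<noteq> x" using pos by eventually_elim (use False in auto)
    then show ?thesis by (intro prob_eq_0[THEN iffD2]) auto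
  qed (rule atomless)
  have "isCont ?F x" for x
    unfolding D.isCont_cdf using null[of x] by (simp add: measure_distr vimage_def Int_def conj_commute)
  then have cont: "continuous_on A ?F" for A
    by (simp add: continuous_at_imp_continuous_on)
  have G: "prob {\<omega> \<in> space M. x \<le> X \<omega>} = 1 - ?F x" for x
  proof -
    have "prob {\<omega> \<in> space M. X \<omega> \<le> x} = prob {\<omega> \<in> space M. X \<omega> < x}"
    proof (rule measure_eq_AE)
      have "AE \<omega> in M. X \<omega> \<noteq> x" using null[of x] prob_eq_0[of "{\<omega> \<in> space M. X \<omega> = x}"] by simp
      then show "AE \<omega> in M. \<omega> \<in> {\<omega> \<in> space M. X \<omega> \<le> x} \<longleftrightarrow> \<omega> \<in> {\<omega> \<in> space M. X \<omega> < x}"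
        by eventually_elim auto
    qed auto
    moreover have "prob {\<omega> \<in> space M. x \<le> X \<omega>} = 1 - prob {\<omega> \<in> space M. X \<omega> < x}"
      by (subst prob_neg[symmetric]) (auto intro!: arg_cong[where f = prob])
    ultimately show ?thesis by (simp add: F)
  qed
  have F0: "?F 0 = 0"
    unfolding F using pos by (intro prob_eq_0[THEN iffD2]) (auto elim!: eventually_mono)
  have S: "S = {0..} \<inter> ?F -` {1 - \<epsilon>..}"
    using \<epsilon> F0 by (auto simp: S_def G less_le)
  have "closed S"
    unfolding S by (intro continuous_closed_preimage cont) auto
  moreover have bdd: "bdd_below S"
    unfolding S by (rule bdd_belowI[of _ 0]) auto
  moreover have "S \<noteq> {}"
  proof -
    have "eventually (\<lambda>x. 1 - \<epsilon> < ?F x) at_top"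
      using D.cdf_lim_at_top_prob \<epsilon> by (intro order_tendstoD(1)) auto
    then have "eventually (\<lambda>x. x \<in> S) at_top"
      using eventually_ge_at_top[of 0] by eventually_elim (simp add: S)
    then show ?thesis by (metis empty_iff eventually_at_top_linorder order_refl)
  qed
  ultimately show "Inf S \<in> S"
    by (intro closed_contains_Inf)
  show "\<And>x. x \<in> S \<Longrightarrow> Inf S \<le> x"
    using bdd by (rule cInf_lower[rotated])
qed

context white_noise
begin

text \<open>
  The covariance forces the variance of \<open>Z \<psi>\<close> to be the squared norm of \<open>\<psi>\<close>; as this is positive,
  the degenerate alternative in the definition of a centered Gaussian variable is excluded.
\<close>

lemma normalized_noise:
  assumes \<psi>: "\<psi> \<in> Lp_space 2" and pos: "0 < Lp_norm 2 \<psi>"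
  shows "distributed P lborel (\<lambda>\<omega>. Z \<psi> \<omega> / Lp_norm 2 \<psi>) std_normal_density"
proof -
  have "Lp_norm 2 \<psi> = sqrt (\<integral>t. \<psi> t * \<psi> t \<partial>cube_measure)"
    by (simp add: Lp_norm_def powr_half_sqrt power2_eq_square)
  then have E: "expectation (\<lambda>\<omega>. Z \<psi> \<omega> * Z \<psi> \<omega>) = (Lp_norm 2 \<psi>)\<^sup>2"
    using covariance[OF \<psi> \<psi>] pos by simp
  have "centered_gaussian P (Z \<psi>)"
    using gaussian[of "{\<psi>}" "\<lambda>_. 1"] \<psi> by simp
  moreover have "\<not> (AE \<omega> in P. Z \<psi> \<omega> = 0)"
  proof
    assume "AE \<omega> in P. Z \<psi> \<omega> = 0"
    then have "expectation (\<lambda>\<omega>. Z \<psi> \<omega> * Z \<psi> \<omega>) = 0"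
      by (intro integral_eq_zero_AE) auto
    with E pos show False by simp
  qed
  ultimately obtain \<sigma> where \<sigma>: "0 < \<sigma>" and D: "distributed P lborel (Z \<psi>) (normal_density 0 \<sigma>)"
    by (auto simp: centered_gaussian_def)
  have "\<sigma>\<^sup>2 = (Lp_norm 2 \<psi>)\<^sup>2"
    using normal_distributed_variance[OF \<sigma> D] normal_distributed_expectation[OF \<sigma> D] E
    by (simp add: power2_eq_square)
  then have "\<sigma> = Lp_norm 2 \<psi>"
    using \<sigma> pos by simp
  then show ?thesis
    using D \<sigma> normal_standard_normal_convert[of \<sigma> "Z \<psi>" 0] by simp
qed

text \<open>
  The critical value is defined as a least element, which has to be shown to exist before
  anything can be said about it.  The maximum of finitely many absolute values of standard normal variables
  is almost surely positive and has no atoms, so the quantile is attained.  The union bound puts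
  \<open>sqrt (2 * ln (n / \<epsilon>))\<close> into the defining set, because at this level each tail is at most
  \<open>\<epsilon> / n\<close>.
\<close>

lemma critical_value:
  assumes fin: "finite \<Psi>" and ne: "\<Psi> \<noteq> {}"
    and L2: "\<And>\<psi>. \<psi> \<in> \<Psi> \<Longrightarrow> \<psi> \<in> Lp_space 2" and pos: "\<And>\<psi>. \<psi> \<in> \<Psi> \<Longrightarrow> 0 < Lp_norm 2 \<psi>"
    and \<epsilon>: "0 < \<epsilon>" "\<epsilon> < 1" and n: "real (card \<Psi>) \<le> n"
  shows critical_value_pos: "0 < critical_value P Z \<epsilon> \<Psi>"
    and prob_exceeds_critical_value:
      "prob {\<omega> \<in> space P. \<exists>\<psi>\<in>\<Psi>. critical_value P Z \<epsilon> \<Psi> * Lp_norm 2 \<psi> \<le> \<bar>Z \<psi> \<omega>\<bar>} \<le> \<epsilon>"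
    and critical_value_le: "critical_value P Z \<epsilon> \<Psi> \<le> sqrt (2 * ln (n / \<epsilon>))"
proof -
  let ?\<xi> = "\<lambda>\<psi> \<omega>. Z \<psi> \<omega> / Lp_norm 2 \<psi>"
  define X where "X \<omega> = Max ((\<lambda>\<psi>. \<bar>Z \<psi> \<omega>\<bar> / Lp_norm 2 \<psi>) ` \<Psi>)" for \<omega>
  have D: "distributed P lborel (?\<xi> \<psi>) std_normal_density" if "\<psi> \<in> \<Psi>" for \<psi>
    using that L2 pos by (intro normalized_noise) auto
  have Zm [measurable]: "Z \<psi> \<in> borel_measurable P" if "\<psi> \<in> \<Psi>" for \<psi>
    using gaussian[of "{\<psi>}" "\<lambda>_. 1"] L2[OF that] by (simp add: centered_gaussian_def)
  have X [measurable]: "X \<in> borel_measurable P"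
    unfolding X_def[abs_def] by (rule borel_measurable_Max[OF fin]) measurable
  have ge_iff: "\<kappa> \<le> X \<omega> \<longleftrightarrow> (\<exists>\<psi>\<in>\<Psi>. \<kappa> * Lp_norm 2 \<psi> \<le> \<bar>Z \<psi> \<omega>\<bar>)" for \<kappa> \<omega>
    unfolding X_def using fin ne by (subst Max_ge_iff) (simp_all add: pos pos_le_divide_eq cong: bex_cong)
  have ne_AE: "AE \<omega> in P. ?\<xi> \<psi> \<omega> \<noteq> x" if "\<psi> \<in> \<Psi>" for \<psi> x
  proof -
    have "AE y in lborel. y \<noteq> x" by (rule AE_lborel_singleton)
    then have "AE y in lborel. 0 < std_normal_density y \<longrightarrow> y \<noteq> x"
      by eventually_elim simp
    then show ?thesis
      using distributed_AE2[OF D[OF that], of "\<lambda>y. y \<noteq> x"] by simp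
  qed
  have X_pos: "AE \<omega> in P. 0 < X \<omega>"
  proof -
    obtain \<psi> where \<psi>: "\<psi> \<in> \<Psi>" using ne by auto
    show ?thesis
      using ne_AE[OF \<psi>, of 0]
    proof eventually_elim
      case (elim \<omega>)
      have "\<bar>Z \<psi> \<omega>\<bar> / Lp_norm 2 \<psi> \<le> X \<omega>"
        unfolding X_def using fin \<psi> by (intro Max_ge) auto
      moreover have "0 < \<bar>Z \<psi> \<omega>\<bar> / Lp_norm 2 \<psi>"
        using elim pos[OF \<psi>] by auto
      ultimately show ?case by linarith
    qed
  qed
  have X_atomless: "prob {\<omega> \<in> space P. X \<omega> = x} = 0" for x
  proof -
    have "AE \<omega> in P. \<forall>\<psi>\<in>\<Psi>. ?\<xi> \<psi> \<omega> \<noteq> x \<and> ?\<xi> \<psi> \<omega> \<noteq> - x"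
      by (rule AE_finite_allI[OF fin]) (rule AE_conjI; rule ne_AE)
    then have "AE \<omega> in P. X \<omega> \<noteq> x"
    proof eventually_elim
      case (elim \<omega>)
      have "X \<omega> \<in> (\<lambda>\<psi>. \<bar>Z \<psi> \<omega>\<bar> / Lp_norm 2 \<psi>) ` \<Psi>"
        unfolding X_def using fin ne by (intro Max_in) auto
      then obtain \<psi> where \<psi>: "\<psi> \<in> \<Psi>" and "X \<omega> = \<bar>Z \<psi> \<omega>\<bar> / Lp_norm 2 \<psi>" by blast
      then have "X \<omega> = \<bar>?\<xi> \<psi> \<omega>\<bar>" using pos[OF \<psi>] by simp
      moreover have "?\<xi> \<psi> \<omega> \<noteq> x \<and> ?\<xi> \<psi> \<omega> \<noteq> - x" using elim \<psi> by blast
      ultimately show ?case by linarith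
    qed
    then show ?thesis by (intro prob_eq_0_AE) simp
  qed
  let ?S = "{\<kappa>. 0 < \<kappa> \<and> prob {\<omega> \<in> space P. \<kappa> \<le> X \<omega>} \<le> \<epsilon>}"
  note attained = upper_quantile_attained[OF X X_pos X_atomless \<epsilon>]
  have cv: "critical_value P Z \<epsilon> \<Psi> = Inf ?S"
    unfolding critical_value_def X_def[symmetric] using attained by (intro Least_equality) auto
  then show "0 < critical_value P Z \<epsilon> \<Psi>"
    using attained(1) by simp
  show "prob {\<omega> \<in> space P. \<exists>\<psi>\<in>\<Psi>. critical_value P Z \<epsilon> \<Psi> * Lp_norm 2 \<psi> \<le> \<bar>Z \<psi> \<omega>\<bar>} \<le> \<epsilon>"
    using attained(1) by (simp add: cv ge_iff)
  \<comment> \<open>the level at which the Gaussian tail bound equals \<open>\<epsilon> / n\<close>\<close>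
  define x where "x = sqrt (2 * ln (n / \<epsilon>))"
  have "0 < card \<Psi>" using fin ne by (simp add: card_gt_0_iff)
  then have n1: "1 \<le> n" using n by linarith
  have ln: "0 < ln (n / \<epsilon>)" using n1 \<epsilon> by simp
  have x: "0 < x" using ln by (simp add: x_def)
  have "exp (- x\<^sup>2 / 2) = \<epsilon> / n"
    using ln n1 \<epsilon> by (simp add: x_def exp_minus)
  then have tail: "prob {\<omega> \<in> space P. x \<le> \<bar>?\<xi> \<psi> \<omega>\<bar>} \<le> \<epsilon> / n" if "\<psi> \<in> \<Psi>" for \<psi>
    using std_normal_tail[OF D[OF that], of x] x by simp
  have "{\<omega> \<in> space P. x \<le> X \<omega>} = (\<Union>\<psi>\<in>\<Psi>. {\<omega> \<in> space P. x \<le> \<bar>?\<xi> \<psi> \<omega>\<bar>})"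
    using pos by (auto simp: ge_iff pos_le_divide_eq less_imp_le)
  then have "prob {\<omega> \<in> space P. x \<le> X \<omega>} \<le> (\<Sum>\<psi>\<in>\<Psi>. prob {\<omega> \<in> space P. x \<le> \<bar>?\<xi> \<psi> \<omega>\<bar>})"
    using fin by (auto intro!: finite_measure_subadditive_finite)
  also have "\<dots> \<le> (\<Sum>\<psi>\<in>\<Psi>. \<epsilon> / n)"
    using tail by (rule sum_mono)
  also have "\<dots> \<le> \<epsilon>"
    using n n1 \<epsilon> by (simp add: field_simps)
  finally have "x \<in> ?S" using x by simp
  then show "critical_value P Z \<epsilon> \<Psi> \<le> sqrt (2 * ln (n / \<epsilon>))"
    using attained(2) by (simp add: cv x_def)
qed

end

section \<open>The selected function\<close>

lemma probe_setE:
  assumes "\<psi> \<in> probe_set p fs N"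
  obtains i j where "i \<in> {1..N}" "j \<in> {1..N}" "i \<noteq> j" "\<psi> = probe p (\<lambda>t. fs i t - fs j t)"
proof -
  from assms obtain i j where "\<psi> = probe p (\<lambda>t. fs i t - fs j t) \<and> i \<in> {1..N} \<and> j \<in> {1..N} \<and> i \<noteq> j"
    unfolding probe_set_def mem_Collect_eq by (elim exE)
  then show ?thesis using that[of i j] by simp
qed

text \<open>
  Separates the bias of the candidate \<open>h\<close>, which duality controls, from the noise.
\<close>

lemma discrepancy_probe:
  assumes p: "1 \<le> p" and g: "g \<in> Lp_space (ennreal p)" and pos: "0 < Lp_norm (ennreal p) g"
    and f: "f \<in> Lp_space (ennreal p)" and h: "h \<in> Lp_space (ennreal p)"
  shows "discrepancy Z \<epsilon> f h (probe p g) \<omega>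
    = (\<integral>t. probe p g t * (f t - h t) \<partial>cube_measure) + \<epsilon> * Z (probe p g) \<omega>"
proof -
  have "(\<integral>t. probe p g t * (f t - h t) \<partial>cube_measure)
      = (\<integral>t. probe p g t * f t \<partial>cube_measure) - (\<integral>t. probe p g t * h t \<partial>cube_measure)"
    unfolding right_diff_distrib
    by (rule Bochner_Integration.integral_diff) (rule probe_times_integrable[OF p g _ pos]; fact)+
  then show ?thesis
    by (simp add: discrepancy_def observation_def)
qed

text \<open>
  When the noise stays within the level \<open>\<kappa> * Lp_norm 2 \<psi>\<close> for every probe, duality bounds the
  criterion at \<open>j\<close> by the distance from \<open>f\<close> to \<open>fs j\<close>, and the criterion at \<open>i\<close> is no larger.
  The probe of \<open>fs j - fs i\<close> recovers the distance between the two functions as the difference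
  of their discrepancies, so that this distance is at most twice the first bound plus twice
  the noise level of that probe.
\<close>

lemma selection_oracle_inequality:
  assumes p: "1 \<le> p" and q: "1 / ennreal p + 1 / q = 1" and \<epsilon>: "0 < \<epsilon>"
    and f: "f \<in> Lp_space (ennreal p)"
    and fs: "\<And>i. i \<in> {1..N} \<Longrightarrow> fs i \<in> Lp_space (ennreal p)"
    and sep: "\<And>i j. i \<in> {1..N} \<Longrightarrow> j \<in> {1..N} \<Longrightarrow> i \<noteq> j \<Longrightarrow> 0 < Lp_norm (ennreal p) (\<lambda>t. fs i t - fs j t)"
    and \<Psi>: "\<Psi> = probe_set p fs N" and fin: "finite \<Psi>"
    and noise: "\<And>\<psi>. \<psi> \<in> \<Psi> \<Longrightarrow> \<bar>Z \<psi> \<omega>\<bar> \<le> \<kappa> * Lp_norm 2 \<psi>"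
    and ij: "i \<in> {1..N}" "j \<in> {1..N}" "i \<noteq> j"
    and crit: "selection_criterion Z \<epsilon> f \<kappa> q \<Psi> (fs i) \<omega> \<le> selection_criterion Z \<epsilon> f \<kappa> q \<Psi> (fs j) \<omega>"
  shows "Lp_norm (ennreal p) (\<lambda>t. fs i t - f t)
    \<le> 3 * Lp_norm (ennreal p) (\<lambda>t. f t - fs j t)
      + 2 * \<epsilon> * \<kappa> * Lp_norm 2 (probe p (\<lambda>t. fs j t - fs i t))"
proof -
  have p0: "0 \<le> p" using p by simp
  let ?crit = "\<lambda>h. selection_criterion Z \<epsilon> f \<kappa> q \<Psi> h \<omega>"
  let ?d = "\<lambda>h \<psi>. discrepancy Z \<epsilon> f h \<psi> \<omega>"
  let ?a = "Lp_norm (ennreal p) (\<lambda>t. f t - fs j t)"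
  let ?g = "\<lambda>t. fs j t - fs i t"
  define \<psi> where "\<psi> = probe p ?g"
  have \<psi>: "\<psi> \<in> \<Psi>" unfolding \<Psi> probe_set_def \<psi>_def using ij by blast
  have \<Psi>E: "\<exists>g. \<phi> = probe p g \<and> g \<in> Lp_space (ennreal p) \<and> 0 < Lp_norm (ennreal p) g"
    if "\<phi> \<in> \<Psi>" for \<phi>
  proof -
    obtain k l where \<phi>: "\<phi> = probe p (\<lambda>t. fs k t - fs l t)" and kl: "k \<in> {1..N}" "l \<in> {1..N}" "k \<noteq> l"
      using \<open>\<phi> \<in> \<Psi>\<close> unfolding \<Psi> by (rule probe_setE)
    have "(\<lambda>t. fs k t - fs l t) \<in> Lp_space (ennreal p)"
      using kl by (intro Lp_space_diff fs p0)
    with \<phi> sep[OF kl] show ?thesis by blast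
  qed
  have q_norm: "Lp_norm q \<phi> = 1" if "\<phi> \<in> \<Psi>" for \<phi>
    using \<Psi>E[OF that] Lp_norm_conjugate_probe[OF p q] by auto
  have crit_eq: "?crit h = Max ((\<lambda>\<phi>. \<bar>?d h \<phi>\<bar> - \<epsilon> * \<kappa> * Lp_norm 2 \<phi>) ` \<Psi>)" for h
    unfolding selection_criterion_def by (rule arg_cong[where f = Max], rule image_cong) (simp_all add: q_norm)
  have upper: "?crit (fs j) \<le> ?a"
  proof -
    have "\<bar>?d (fs j) \<phi>\<bar> - \<epsilon> * \<kappa> * Lp_norm 2 \<phi> \<le> ?a" if "\<phi> \<in> \<Psi>" for \<phi>
    proof -
      obtain g where g: "\<phi> = probe p g" "g \<in> Lp_space (ennreal p)" "0 < Lp_norm (ennreal p) g"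
        using \<Psi>E[OF \<open>\<phi> \<in> \<Psi>\<close>] by blast
      have "\<bar>\<integral>t. \<phi> t * (f t - fs j t) \<partial>cube_measure\<bar> \<le> ?a"
        unfolding g(1) using p g f fs[OF ij(2)] by (intro probe_integral_le Lp_space_diff p0)
      moreover have "\<bar>\<epsilon> * Z \<phi> \<omega>\<bar> \<le> \<epsilon> * \<kappa> * Lp_norm 2 \<phi>"
        using noise[OF \<open>\<phi> \<in> \<Psi>\<close>] \<epsilon> by (simp add: abs_mult mult.assoc)
      moreover have "?d (fs j) \<phi> = (\<integral>t. \<phi> t * (f t - fs j t) \<partial>cube_measure) + \<epsilon> * Z \<phi> \<omega>"
        unfolding g(1) by (rule discrepancy_probe[OF p g(2,3) f fs[OF ij(2)]])
      ultimately show ?thesis by linarith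
    qed
    then show ?thesis
      unfolding crit_eq using fin \<psi> by (intro Max.boundedI) auto
  qed
  have lower: "\<bar>?d h \<psi>\<bar> \<le> ?crit h + \<epsilon> * \<kappa> * Lp_norm 2 \<psi>" for h
  proof -
    have "\<bar>?d h \<psi>\<bar> - \<epsilon> * \<kappa> * Lp_norm 2 \<psi> \<le> ?crit h"
      unfolding crit_eq using fin \<psi> by (intro Max_ge) auto
    then show ?thesis by simp
  qed
  have g: "?g \<in> Lp_space (ennreal p)" and g_pos: "0 < Lp_norm (ennreal p) ?g"
    using ij fs sep by (auto intro!: Lp_space_diff p0)
  \<comment> \<open>the unknown signal cancels in the difference of the two discrepancies\<close>
  have "Lp_norm (ennreal p) ?g = (\<integral>t. \<psi> t * ?g t \<partial>cube_measure)"
    unfolding \<psi>_def by (rule probe_integral_self[OF p g_pos, symmetric])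
  also have "\<dots> = (\<integral>t. \<psi> t * fs j t \<partial>cube_measure) - (\<integral>t. \<psi> t * fs i t \<partial>cube_measure)"
    unfolding \<psi>_def right_diff_distrib
    by (rule Bochner_Integration.integral_diff) (rule probe_times_integrable[OF p g fs g_pos]; fact)+
  also have "\<dots> = ?d (fs i) \<psi> - ?d (fs j) \<psi>"
    by (simp add: discrepancy_def)
  also have "\<dots> \<le> 2 * ?a + 2 * \<epsilon> * \<kappa> * Lp_norm 2 \<psi>"
    using lower[of "fs i"] lower[of "fs j"] crit upper by linarith
  finally have "Lp_norm (ennreal p) (\<lambda>t. fs i t - fs j t) \<le> 2 * ?a + 2 * \<epsilon> * \<kappa> * Lp_norm 2 \<psi>"
    by (simp add: Lp_norm_minus_commute[of _ "fs i"])
  moreover have "Lp_norm (ennreal p) (\<lambda>t. fs i t - f t)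
      \<le> Lp_norm (ennreal p) (\<lambda>t. fs i t - fs j t) + Lp_norm (ennreal p) (\<lambda>t. fs j t - f t)"
    using p f fs ij by (intro Lp_norm_triangle)
  ultimately show ?thesis
    unfolding \<psi>_def[symmetric] Lp_norm_minus_commute[of _ "fs j" f] by linarith
qed

lemma Q1_nonneg:
  assumes "2 \<le> N"
  shows "0 \<le> Q1 p fs N i"
proof -
  have "card ({1..N} - {i}) \<noteq> 0"
    using assms by (cases "i \<in> {1..N}") auto
  then obtain k where k: "k \<in> {1..N} - {i}"
    by (metis all_not_in_conv card.empty)
  show ?thesis
  proof (cases "p \<le> 2")
    case False
    show ?thesis
      unfolding Q1_def if_not_P[OF False] using k by (subst Max_ge_iff) auto
  qed (simp add: Q1_def)
qed

text \<open>
  The quantity \<open>Q1\<close> takes its maximum over the differences from the single index \<open>i\<close>.  This suffices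
  because the only probes entering the error bound are those that compare the selected function
  with the oracle.
\<close>

lemma probe_L2_norm_le_Q1:
  assumes p: "1 \<le> p" and k: "k \<in> {1..N}" "k \<noteq> i"
    and g: "(\<lambda>t. fs i t - fs k t) \<in> Lp_space (ennreal p)"
    and pos: "0 < Lp_norm (ennreal p) (\<lambda>t. fs i t - fs k t)"
  shows "Lp_norm 2 (probe p (\<lambda>t. fs i t - fs k t)) \<le> Q1 p fs N i"
proof (cases "p \<le> 2")
  case True
  then show ?thesis using probe_L2_norm_le_1[OF p _ g pos] by (simp add: Q1_def)
next
  case False
  then have "Lp_norm 2 (probe p (\<lambda>t. fs i t - fs k t))
      = (Lp_norm (ennreal (2 * p - 2)) (\<lambda>t. fs i t - fs k t) /
         Lp_norm (ennreal p) (\<lambda>t. fs i t - fs k t)) powr (p - 1)"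
    by (intro probe_L2_norm) simp
  then show ?thesis
    unfolding Q1_def if_not_P[OF False] using k by (auto intro!: Max_ge)
qed

theorem corollary1:
  fixes P :: "'w measure"
    and Z :: "(real ^ 'd \<Rightarrow> real) \<Rightarrow> 'w \<Rightarrow> real"
    and \<epsilon> p L \<kappa> :: real
    and q :: ennreal
    and N i_star :: nat
    and f :: "real ^ 'd \<Rightarrow> real"
    and fs :: "nat \<Rightarrow> real ^ 'd \<Rightarrow> real"
    and \<Psi> :: "(real ^ 'd \<Rightarrow> real) set"
    and i_hat :: "'w \<Rightarrow> nat"
  assumes noise: "white_noise P Z"
    and eps: "0 < \<epsilon>" "\<epsilon> < 1"
    and p: "1 \<le> p"
    and q: "1 / ennreal p + 1 / q = 1"
    and N: "2 \<le> N"
    and f_Lp: "f \<in> Lp_space (ennreal p)"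
    and fs_Lp: "\<And>i. i \<in> {1..N} \<Longrightarrow> fs i \<in> Lp_space (ennreal p)"
    and distinct: "\<And>i j. i \<in> {1..N} \<Longrightarrow> j \<in> {1..N} \<Longrightarrow> i \<noteq> j \<Longrightarrow>
      \<not> (AE t in cube_measure. fs i t = fs j t)"
    and norms_finite: "\<And>i j. p > 2 \<Longrightarrow> i \<in> {1..N} \<Longrightarrow> j \<in> {1..N} \<Longrightarrow> i \<noteq> j \<Longrightarrow>
      (\<lambda>t. fs i t - fs j t) \<in> Lp_space (ennreal (2 * p - 2))"
    and L: "L = Max (insert (Lp_norm (ennreal p) f)
      ((\<lambda>i. Lp_norm (ennreal p) (fs i)) ` {1..N}))"
    and Psi: "\<Psi> = probe_set p fs N"
    and kappa: "\<kappa> = critical_value P Z \<epsilon> \<Psi>"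
    and i_hat_measurable: "i_hat \<in> measurable P (count_space UNIV)"
    and i_hat: "\<And>\<omega>. \<omega> \<in> space P \<Longrightarrow>
      is_arg_min (\<lambda>i. selection_criterion Z \<epsilon> f \<kappa> q \<Psi> (fs i) \<omega>) (\<lambda>i. i \<in> {1..N}) (i_hat \<omega>)"
    and i_star: "is_arg_min (\<lambda>i. Lp_norm (ennreal p) (\<lambda>t. f t - fs i t)) (\<lambda>i. i \<in> {1..N}) i_star"
  shows "risk P (ennreal p) (\<lambda>\<omega>. fs (i_hat \<omega>)) f
    \<le> 3 * Min ((\<lambda>i. Lp_norm (ennreal p) (\<lambda>t. f t - fs i t)) ` {1..N})
      + 2 * Q1 p fs N i_star * \<epsilon> * sqrt (2 * ln (real N ^ 2 / \<epsilon>))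
      + 2 * L * \<epsilon>"
proof -
  interpret white_noise P Z by (rule noise)
  have p0: "0 \<le> p" "0 < p" using p by auto
  have diff_Lp: "(\<lambda>t. fs i t - fs j t) \<in> Lp_space (ennreal p)" if "i \<in> {1..N}" "j \<in> {1..N}" for i j
    using that by (intro Lp_space_diff fs_Lp p0)
  have sep: "0 < Lp_norm (ennreal p) (\<lambda>t. fs i t - fs j t)" if "i \<in> {1..N}" "j \<in> {1..N}" "i \<noteq> j" for i j
    using distinct[OF that] diff_Lp[OF that(1,2)] p0 by (intro Lp_norm_pos) auto
  let ?index = "{1..N} \<times> {1..N}"
  have sub: "\<Psi> \<subseteq> (\<lambda>(i, j). probe p (\<lambda>t. fs i t - fs j t)) ` ?index"
  proof
    fix \<psi> assume "\<psi> \<in> \<Psi>"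
    then obtain i j where "i \<in> {1..N}" "j \<in> {1..N}" "\<psi> = probe p (\<lambda>t. fs i t - fs j t)"
      unfolding Psi by (rule probe_setE)
    then show "\<psi> \<in> (\<lambda>(i, j). probe p (\<lambda>t. fs i t - fs j t)) ` ?index"
      by (intro image_eqI[of _ _ "(i, j)"]) simp_all
  qed
  have fin: "finite \<Psi>"
    by (rule finite_subset[OF sub]) simp
  have "card \<Psi> \<le> card ?index"
    by (rule order_trans[OF card_mono[OF _ sub] card_image_le]) simp_all
  also have "\<dots> = N\<^sup>2"
    by (simp add: power2_eq_square)
  finally have card: "real (card \<Psi>) \<le> real N ^ 2"
    by (metis of_nat_le_iff of_nat_power)
  have "probe p (\<lambda>t. fs 1 t - fs 2 t) \<in> \<Psi>"
    unfolding Psi probe_set_def using N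
    by (intro CollectI exI[of _ 1] exI[of _ 2]) simp
  then have ne: "\<Psi> \<noteq> {}" by blast
  have \<Psi>: "\<psi> \<in> Lp_space 2 \<and> 0 < Lp_norm 2 \<psi>" if \<psi>_in: "\<psi> \<in> \<Psi>" for \<psi>
  proof -
    obtain i j where ij: "i \<in> {1..N}" "j \<in> {1..N}" "i \<noteq> j" and \<psi>: "\<psi> = probe p (\<lambda>t. fs i t - fs j t)"
      using \<psi>_in unfolding Psi by (rule probe_setE)
    have "probe p (\<lambda>t. fs i t - fs j t) \<in> Lp_space 2"
      using ij by (intro probe_in_L2 p diff_Lp norms_finite)
    with probe_L2_pos[OF p diff_Lp[OF ij(1,2)] sep[OF ij]] show ?thesis by (simp add: \<psi>)
  qed
  have \<kappa>: "0 < \<kappa>" "\<kappa> \<le> sqrt (2 * ln (real N ^ 2 / \<epsilon>))"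
    and prob_bad: "prob {\<omega> \<in> space P. \<exists>\<psi>\<in>\<Psi>. \<kappa> * Lp_norm 2 \<psi> \<le> \<bar>Z \<psi> \<omega>\<bar>} \<le> \<epsilon>"
    unfolding kappa by (rule critical_value[OF fin ne _ _ eps card]; use \<Psi> in blast)+
  define bad where "bad = {\<omega> \<in> space P. \<exists>\<psi>\<in>\<Psi>. \<kappa> * Lp_norm 2 \<psi> \<le> \<bar>Z \<psi> \<omega>\<bar>}"
  have bad: "bad \<in> events"
  proof -
    have [measurable]: "Z \<psi> \<in> borel_measurable P" if "\<psi> \<in> \<Psi>" for \<psi>
      using gaussian[of "{\<psi>}" "\<lambda>_. 1"] \<Psi>[OF that] by (simp add: centered_gaussian_def)
    show ?thesis unfolding bad_def using fin by measurable
  qed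
  let ?a = "Lp_norm (ennreal p) (\<lambda>t. f t - fs i_star t)"
  have star: "i_star \<in> {1..N}" and star_le: "\<And>i. i \<in> {1..N} \<Longrightarrow> ?a \<le> Lp_norm (ennreal p) (\<lambda>t. f t - fs i t)"
    using i_star by (auto simp: is_arg_min_linorder)
  have Min: "Min ((\<lambda>i. Lp_norm (ennreal p) (\<lambda>t. f t - fs i t)) ` {1..N}) = ?a"
    using star star_le by (intro Min_eqI) auto
  have hat: "i_hat \<omega> \<in> {1..N}" if "\<omega> \<in> space P" for \<omega>
    using i_hat[OF that] by (simp add: is_arg_min_linorder)
  have a0: "0 \<le> ?a" by (rule Lp_norm_nonneg)
  have Q0: "0 \<le> Q1 p fs N i_star" using N by (rule Q1_nonneg)
  let ?R = "\<lambda>\<omega>. Lp_norm (ennreal p) (\<lambda>t. fs (i_hat \<omega>) t - f t)"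
  let ?C = "3 * ?a + 2 * Q1 p fs N i_star * \<epsilon> * \<kappa>"
  have C0: "0 \<le> ?C" using a0 Q0 eps \<kappa> by simp
  have R_le: "?R \<omega> \<le> 2 * L" if "\<omega> \<in> space P" for \<omega>
  proof -
    have "Lp_norm (ennreal p) f \<le> L" "Lp_norm (ennreal p) (fs (i_hat \<omega>)) \<le> L"
      unfolding L using hat[OF that] by (intro Max_ge; blast)+
    then show ?thesis
      using Lp_norm_diff_le[OF p fs_Lp[OF hat[OF that]] f_Lp] by simp
  qed
  have R_good: "?R \<omega> \<le> ?C" if \<omega>: "\<omega> \<in> space P" "\<omega> \<notin> bad" for \<omega>
  proof (cases "i_hat \<omega> = i_star")
    case True
    then show ?thesis
      using a0 Q0 eps \<kappa> by (simp add: Lp_norm_minus_commute[of _ "fs i_star" f])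
  next
    case False
    note ij = hat[OF \<omega>(1)] star False
    have "?R \<omega> \<le> 3 * ?a + 2 * \<epsilon> * \<kappa> * Lp_norm 2 (probe p (\<lambda>t. fs i_star t - fs (i_hat \<omega>) t))"
    proof (rule selection_oracle_inequality[where Z = Z and \<omega> = \<omega>, OF p q eps(1) f_Lp fs_Lp sep Psi fin _ ij])
      show "\<bar>Z \<psi> \<omega>\<bar> \<le> \<kappa> * Lp_norm 2 \<psi>" if "\<psi> \<in> \<Psi>" for \<psi>
      proof (rule ccontr)
        assume "\<not> ?thesis"
        then have "\<kappa> * Lp_norm 2 \<psi> \<le> \<bar>Z \<psi> \<omega>\<bar>" by simp
        with \<omega> that show False unfolding bad_def by blast
      qed
      show "selection_criterion Z \<epsilon> f \<kappa> q \<Psi> (fs (i_hat \<omega>)) \<omega> \<le> selection_criterion Z \<epsilon> f \<kappa> q \<Psi> (fs i_star) \<omega>"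
        using i_hat[OF \<omega>(1)] star by (simp add: is_arg_min_linorder)
    qed
    also have "\<dots> \<le> 3 * ?a + 2 * \<epsilon> * \<kappa> * Q1 p fs N i_star"
      using ij eps \<kappa> by (intro add_left_mono mult_left_mono probe_L2_norm_le_Q1 p diff_Lp sep) auto
    finally show ?thesis by (simp add: mult_ac)
  qed
  have L0: "0 \<le> 2 * L"
  proof -
    obtain \<omega> where "\<omega> \<in> space P" using not_empty by blast
    from R_le[OF this] show ?thesis
      by (rule order_trans[OF Lp_norm_nonneg])
  qed
  have "?R \<in> borel_measurable P"
    using measurable_compose[OF i_hat_measurable, of "\<lambda>i. Lp_norm (ennreal p) (\<lambda>t. fs i t - f t)" borel] by simp
  then have int: "integrable P ?R"
    by (rule integrable_const_bound[where B = "2 * L", rotated])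
       (rule AE_I2, simp only: real_norm_def abs_of_nonneg[OF Lp_norm_nonneg] R_le)
  have "risk P (ennreal p) (\<lambda>\<omega>. fs (i_hat \<omega>)) f \<le> expectation (\<lambda>\<omega>. ?C + 2 * L * indicator bad \<omega>)"
    unfolding risk_def
  proof (rule integral_mono)
    show "integrable P (\<lambda>\<omega>. ?C + 2 * L * indicator bad \<omega>)"
      using bad by (intro Bochner_Integration.integrable_add integrable_const integrable_mult_right)
        (simp add: integrable_indicator_iff emeasure_eq_measure)
    show "?R \<omega> \<le> ?C + 2 * L * indicator bad \<omega>" if "\<omega> \<in> space P" for \<omega>
      using R_le[OF that] R_good[OF that] C0 by (cases "\<omega> \<in> bad") auto
  qed (rule int)
  also have "\<dots> = ?C + 2 * L * prob bad"
    using bad by (subst Bochner_Integration.integral_add)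
      (auto simp: prob_space emeasure_eq_measure integrable_indicator_iff)
  also have "\<dots> \<le> 3 * ?a + 2 * Q1 p fs N i_star * \<epsilon> * sqrt (2 * ln (real N ^ 2 / \<epsilon>)) + 2 * L * \<epsilon>"
    using prob_bad[folded bad_def] \<kappa>(2) L0 Q0 eps by (intro add_mono mult_left_mono) auto
  finally show ?thesis
    unfolding Min .
qed

end
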